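(* Let $k \ge 4$ and $\ell < \binom{k}{2}$ be integers, and let $G$ be a $B+M_\ell$ graph. Then $\mathrm{Kc}(G,k) = 1$, i.e., any two $k$-colorings of $G$ are Kempe equivalent.
   Context: All graphs are finite and simple. A $k$-coloring of a graph $G$ is a map $c: V(G) \to \{1,\dots,k\}$ with $c(u)\neq c(v)$ for every edge $uv$ (not all colors need be used). For a colored graph and distinct colors $i,j$, $G(i,j)$ is the subgraph induced by the vertices colored $i$ or $j$; a Kempe change (K-change) is the operation of swapping colors $i$ and $j$ on one connected component of $G(i,j)$. Two $k$-colorings are Kempe equivalent if one can be obtained from the other by a finite sequence of Kempe changes (possibly with different pairs of colors from $\{1,\dots,k\}$). $\mathrm{Kc}(G,k)$ denotes the number of Kempe equivalence classes of the set of all $k$-colorings of $G$. A $B+M_\ell$ graph is a graph obtained from a bipartite graph $B$ with partite sets $S$ and $T$ by adding a matching of $\ell$ new edges, each joining two vertices lying in the same partite set ($S$ or $T$). *)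

theory Defs
  imports Main "HOL-Library.FuncSet" "HOL-Combinatorics.Transposition"
begin

datatype 'a graph = Graph (verts: "'a set") (edges: "'a set set")

definition simple_graph :: "'a graph \<Rightarrow> bool" where
  "simple_graph G \<longleftrightarrow> finite (verts G) \<and> (\<forall>e\<in>edges G. e \<subseteq> verts G \<and> card e = 2)"

definition induced_subgraph :: "'a graph \<Rightarrow> 'a set \<Rightarrow> 'a graph" where
  "induced_subgraph G W = Graph (verts G \<inter> W) {e \<in> edges G. e \<subseteq> W}"

definition component_of :: "'a graph \<Rightarrow> 'a \<Rightarrow> 'a set" where
  "component_of G v = {w. (\<lambda>x y. {x, y} \<in> edges G)\<^sup>*\<^sup>* v w}"

definition components :: "'a graph \<Rightarrow> 'a set set" where
  "components G = component_of G ` verts G"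

text \<open>Colorings are extensional functions, so that distinct elements of the following set
  differ on a vertex of the graph.\<close>

definition colorings :: "'a graph \<Rightarrow> nat \<Rightarrow> ('a \<Rightarrow> nat) set" where
  "colorings G k =
    {c \<in> verts G \<rightarrow>\<^sub>E {1..k}. \<forall>u v. {u, v} \<in> edges G \<longrightarrow> c u \<noteq> c v}"

definition color_subgraph :: "'a graph \<Rightarrow> ('a \<Rightarrow> nat) \<Rightarrow> nat \<Rightarrow> nat \<Rightarrow> 'a graph" where
  "color_subgraph G c i j = induced_subgraph G {v \<in> verts G. c v = i \<or> c v = j}"

definition swap_colors_on :: "'a set \<Rightarrow> nat \<Rightarrow> nat \<Rightarrow> ('a \<Rightarrow> nat) \<Rightarrow> 'a \<Rightarrow> nat" where
  "swap_colors_on C i j c = (\<lambda>v. if v \<in> C then transpose i j (c v) else c v)"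

definition kempe_change :: "'a graph \<Rightarrow> nat \<Rightarrow> ('a \<Rightarrow> nat) \<Rightarrow> ('a \<Rightarrow> nat) \<Rightarrow> bool" where
  "kempe_change G k c d \<longleftrightarrow>
    (\<exists>i\<in>{1..k}. \<exists>j\<in>{1..k}. i \<noteq> j \<and>
      (\<exists>C\<in>components (color_subgraph G c i j). d = swap_colors_on C i j c))"

definition kempe_equivalence :: "'a graph \<Rightarrow> nat \<Rightarrow> (('a \<Rightarrow> nat) \<times> ('a \<Rightarrow> nat)) set" where
  "kempe_equivalence G k =
    {(c, d). c \<in> colorings G k \<and> d \<in> colorings G k \<and> (kempe_change G k)\<^sup>*\<^sup>* c d}"

definition Kc :: "'a graph \<Rightarrow> nat \<Rightarrow> nat" where
  "Kc G k = card (colorings G k // kempe_equivalence G k)"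

definition bipartite_with :: "'a graph \<Rightarrow> 'a set \<Rightarrow> 'a set \<Rightarrow> bool" where
  "bipartite_with B S T \<longleftrightarrow> simple_graph B \<and> S \<union> T = verts B \<and> S \<inter> T = {} \<and>
    (\<forall>e\<in>edges B. \<exists>s\<in>S. \<exists>t\<in>T. e = {s, t})"

text \<open>The added edges are automatically new: an edge inside a partite set is not an edge of
  the bipartite graph.\<close>

definition B_plus_M :: "nat \<Rightarrow> 'a graph \<Rightarrow> bool" where
  "B_plus_M l G \<longleftrightarrow> (\<exists>B S T M. bipartite_with B S T \<and>
    (\<forall>e\<in>M. card e = 2 \<and> (e \<subseteq> S \<or> e \<subseteq> T)) \<and> pairwise disjnt M \<and> card M = l \<and>
    G = Graph (verts B) (edges B \<union> M))"

lemma kempe_change_colorings: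
  assumes G: "simple_graph G" and c: "c \<in> colorings G k" and cd: "kempe_change G k c d"
  shows "d \<in> colorings G k" and "kempe_change G k d c"
proof -
  from cd obtain i j v where ij: "i \<in> {1..k}" "j \<in> {1..k}" "i \<noteq> j"
    and v: "v \<in> verts (color_subgraph G c i j)"
    and d: "d = swap_colors_on (component_of (color_subgraph G c i j) v) i j c"
    unfolding kempe_change_def components_def by auto
  let ?H = "color_subgraph G c i j"
  let ?C = "component_of ?H v"
  have vH: "v \<in> verts G" "c v = i \<or> c v = j"
    using v by (auto simp: color_subgraph_def induced_subgraph_def)
  have CH: "w \<in> verts G \<and> (c w = i \<or> c w = j)" if "w \<in> ?C" for w
  proof -
    have "(\<lambda>x y. {x, y} \<in> edges ?H)\<^sup>*\<^sup>* v w" using that by (simp add: component_of_def)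
    then show ?thesis
      by (induction) (use vH in \<open>auto simp: color_subgraph_def induced_subgraph_def\<close>)
  qed
  have step: "y \<in> ?C" if "x \<in> ?C" "{x, y} \<in> edges ?H" for x y
    using that by (auto simp: component_of_def intro: rtranclp.rtrancl_into_rtrancl)
  have dC: "d w = i \<or> d w = j \<longleftrightarrow> c w = i \<or> c w = j" for w
    unfolding d swap_colors_on_def using ij by (auto simp: transpose_def)
  have H: "color_subgraph G d i j = ?H"
    unfolding color_subgraph_def dC ..
  have edge: "{x, y} \<in> edges ?H"
    if "{x, y} \<in> edges G" "c x = i \<or> c x = j" "c y = i \<or> c y = j" for x y
    using that G by (auto simp: color_subgraph_def induced_subgraph_def simple_graph_def)
  have dne: "d x \<noteq> d y" if xy: "{x, y} \<in> edges G" for x y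
  proof -
    have ne: "c x \<noteq> c y" using c xy by (auto simp: colorings_def)
    show ?thesis
    proof (cases "(c x = i \<or> c x = j) \<and> (c y = i \<or> c y = j)")
      case True
      then have "{x, y} \<in> edges ?H" "{y, x} \<in> edges ?H"
        using edge xy by (auto simp: insert_commute)
      then have "x \<in> ?C \<longleftrightarrow> y \<in> ?C" using step by blast
      then show ?thesis using ne by (auto simp: d swap_colors_on_def transpose_eq_iff)
    next
      case False
      have out: "d z = c z" if "\<not> (c z = i \<or> c z = j)" for z
        using that CH[of z] by (auto simp: d swap_colors_on_def)
      show ?thesis using False ne dC out by metis
    qed
  qed
  have "d w \<in> {1..k}" if "w \<in> verts G" for w
    using that c ij by (auto simp: colorings_def d swap_colors_on_def transpose_def PiE_def Pi_def)
  moreover have "d w = undefined" if "w \<notin> verts G" for w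
    using that c CH[of w] by (auto simp: colorings_def d swap_colors_on_def PiE_def extensional_def)
  ultimately show "d \<in> colorings G k"
    using dne by (auto simp: colorings_def PiE_def extensional_def)
  have "c = swap_colors_on ?C i j d"
    by (auto simp: d swap_colors_on_def)
  moreover have "?C \<in> components (color_subgraph G d i j)"
    unfolding H components_def using v by blast
  ultimately show "kempe_change G k d c"
    unfolding kempe_change_def using ij by blast
qed

lemma equiv_kempe_equivalence:
  assumes "simple_graph G"
  shows "equiv (colorings G k) (kempe_equivalence G k)"
proof (rule equivI)
  show "kempe_equivalence G k \<subseteq> colorings G k \<times> colorings G k"
    by (auto simp: kempe_equivalence_def)
  show "refl_on (colorings G k) (kempe_equivalence G k)"
    by (auto simp: refl_on_def kempe_equivalence_def)
  have "d \<in> colorings G k \<and> (kempe_change G k)\<^sup>*\<^sup>* d c"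
    if "(kempe_change G k)\<^sup>*\<^sup>* c d" "c \<in> colorings G k" for c d
    using that
    by induction (auto dest: kempe_change_colorings[OF assms]
        intro: converse_rtranclp_into_rtranclp)
  then show "sym (kempe_equivalence G k)"
    by (auto simp: sym_def kempe_equivalence_def)
  show "trans (kempe_equivalence G k)"
    by (auto simp: trans_def kempe_equivalence_def)
qed

lemma Kc_eq_1_iff:
  assumes "simple_graph G"
  shows "Kc G k = 1 \<longleftrightarrow> colorings G k \<noteq> {} \<and>
    (\<forall>c\<in>colorings G k. \<forall>d\<in>colorings G k. (kempe_change G k)\<^sup>*\<^sup>* c d)"
    (is "?L \<longleftrightarrow> ?R")
proof
  assume ?L
  then obtain X where X: "colorings G k // kempe_equivalence G k = {X}"
    unfolding Kc_def by (auto simp: card_1_singleton_iff)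
  then have "colorings G k \<noteq> {}" by (auto simp: quotient_def)
  moreover have "(kempe_change G k)\<^sup>*\<^sup>* c d"
    if "c \<in> colorings G k" "d \<in> colorings G k" for c d
  proof -
    have "kempe_equivalence G k `` {c} = X" "kempe_equivalence G k `` {d} = X"
      using X that quotientI[of _ "colorings G k" "kempe_equivalence G k"] by auto
    then have "(c, d) \<in> kempe_equivalence G k"
      using eq_equiv_class[OF _ equiv_kempe_equivalence[OF assms]] that by metis
    then show ?thesis by (simp add: kempe_equivalence_def)
  qed
  ultimately show ?R by blast
next
  assume R: ?R
  then have "kempe_equivalence G k `` {c} = colorings G k" if "c \<in> colorings G k" for c
    using that by (auto simp: kempe_equivalence_def)
  then have "colorings G k // kempe_equivalence G k = {colorings G k}"
    using R by (auto simp: quotient_def)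
  then show ?L by (simp add: Kc_def)
qed

end

theory Submission
  imports Defs
begin

text \<open>
  Fewer than \<open>k choose 2\<close> matching edges leave some pair of colors \<open>a, b\<close> on no matching edge, so
  the components of \<open>G(a, b)\<close> are bipartite along \<open>S, T\<close> and can be flipped until \<open>S\<close> avoids \<open>b\<close>
  and \<open>T\<close> avoids \<open>a\<close>.  A vertex of \<open>S\<close> can then be recolored \<open>a\<close> unless its matching partner has
  color \<open>a\<close>, and likewise for \<open>T\<close> and \<open>b\<close>; once this is exhausted every matching edge has an end
  colored \<open>a\<close> (in \<open>S\<close>) or \<open>b\<close> (in \<open>T\<close>).  Hence two further colors \<open>x, y\<close>, which exist because
  \<open>k \<ge> 4\<close>, occur together on no matching edge, and they can be separated in the same way.  Now the
  vertices of \<open>S\<close> not colored \<open>a\<close> can all be recolored \<open>x\<close> and those of \<open>T\<close> not colored \<open>b\<close> can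
  all be recolored \<open>y\<close>.  Colorings with \<open>S\<close> on two colors and \<open>T\<close> on two others are
  equivalent by permuting colors and flipping matching edges.
\<close>

section \<open>Recoloring within two colors\<close>

lemma colorings_edge: "c \<in> colorings G k \<Longrightarrow> {u, v} \<in> edges G \<Longrightarrow> c u \<noteq> c v"
  by (auto simp: colorings_def)

lemma colorings_range: "c \<in> colorings G k \<Longrightarrow> v \<in> verts G \<Longrightarrow> c v \<in> {1..k}"
  by (auto simp: colorings_def)

lemma colorings_eqI:
  assumes "c \<in> colorings G k" "d \<in> colorings G k" "\<And>v. v \<in> verts G \<Longrightarrow> c v = d v"
  shows "c = d"
  using assms by (auto simp: colorings_def intro: PiE_ext)

lemma kempe_reach_colorings:
  assumes "simple_graph G" "(kempe_change G k)\<^sup>*\<^sup>* c d" "c \<in> colorings G k"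
  shows "d \<in> colorings G k"
  using assms(2,3) by induction (auto dest: kempe_change_colorings[OF assms(1)])

lemma kempe_reach_sym:
  assumes "simple_graph G" "(kempe_change G k)\<^sup>*\<^sup>* c d" "c \<in> colorings G k"
  shows "(kempe_change G k)\<^sup>*\<^sup>* d c"
proof -
  have "(c, d) \<in> kempe_equivalence G k"
    using assms kempe_reach_colorings by (auto simp: kempe_equivalence_def)
  then have "(d, c) \<in> kempe_equivalence G k"
    using equiv_kempe_equivalence[OF assms(1)] by (auto simp: equiv_def dest: symD)
  then show ?thesis by (simp add: kempe_equivalence_def)
qed

text \<open>On a component of \<open>G(i, j)\<close> the colorings \<open>c\<close> and \<open>d\<close> agree everywhere or differ everywhere,
  so flipping the components on which they differ turns \<open>c\<close> into \<open>d\<close>.\<close>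

lemma kempe_reach_two_colors:
  assumes G: "simple_graph G" and ij: "i \<in> {1..k}" "j \<in> {1..k}" "i \<noteq> j"
    and c: "c \<in> colorings G k" and d: "d \<in> colorings G k"
    and cd: "\<And>v. v \<in> verts G \<Longrightarrow> c v = d v \<or> c v \<in> {i, j} \<and> d v \<in> {i, j}"
  shows "(kempe_change G k)\<^sup>*\<^sup>* c d"
  using c cd
proof (induction "card {v \<in> verts G. c v \<noteq> d v}" arbitrary: c rule: less_induct)
  case less
  have fin: "finite (verts G)" using G by (simp add: simple_graph_def)
  show ?case
  proof (cases "\<exists>v\<in>verts G. c v \<noteq> d v")
    case False
    then have "c = d" using colorings_eqI[OF less.prems(1) d] by blast
    then show ?thesis by simp
  next
    case True
    then obtain v where v: "v \<in> verts G" "c v \<noteq> d v" by blast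
    let ?H = "color_subgraph G c i j"
    let ?C = "component_of ?H v"
    let ?c = "swap_colors_on ?C i j c"
    have C: "w \<in> verts G \<and> c w \<in> {i, j} \<and> d w \<in> {i, j} \<and> c w \<noteq> d w" if "w \<in> ?C" for w
    proof -
      have "(\<lambda>x y. {x, y} \<in> edges ?H)\<^sup>*\<^sup>* v w" using that by (simp add: component_of_def)
      then show ?thesis
      proof induction
        case base
        then show ?case using v less.prems(2) by blast
      next
        case (step x y)
        have e: "{x, y} \<in> edges G" and y: "y \<in> verts G" "c y \<in> {i, j}"
          using step.hyps by (auto simp: color_subgraph_def induced_subgraph_def)
        have "c x \<noteq> c y" "d x \<noteq> d y"
          using colorings_edge[OF less.prems(1) e] colorings_edge[OF d e] .
        moreover have "d y \<in> {i, j}" using y less.prems(2)[of y] by metis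
        \<comment> \<open>\<open>c x\<close> and \<open>d x\<close> are the two different members of
          \<open>{i, j}\<close>, so properness of both colorings forces \<open>c y = d x\<close> and
          \<open>d y = c x\<close>.\<close>
        ultimately show ?case using step.IH y by (smt (verit) insert_iff empty_iff)
      qed
    qed
    \<comment> \<open>On the component, exchanging \<open>i\<close> and \<open>j\<close> produces
      exactly the values of \<open>d\<close>, so the set of disagreement shrinks and loses at least
      \<open>v\<close>.\<close>
    have sw: "?c w = (if w \<in> ?C then d w else c w)" for w
      using C[of w] by (auto simp: swap_colors_on_def transpose_def)
    have vC: "v \<in> ?C" by (simp add: component_of_def)
    have "?C \<in> components ?H"
      using v C[OF vC] by (auto simp: components_def color_subgraph_def induced_subgraph_def)
    then have ch: "kempe_change G k c ?c" using ij unfolding kempe_change_def by blast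
    have c': "?c \<in> colorings G k" using kempe_change_colorings(1)[OF G less.prems(1) ch] .
    have "{v \<in> verts G. ?c v \<noteq> d v} \<subset> {v \<in> verts G. c v \<noteq> d v}"
      using v vC unfolding sw by auto
    then have "card {v \<in> verts G. ?c v \<noteq> d v} < card {v \<in> verts G. c v \<noteq> d v}"
      using fin by (intro psubset_card_mono) auto
    moreover have "?c v = d v \<or> ?c v \<in> {i, j} \<and> d v \<in> {i, j}" if "v \<in> verts G" for v
      using less.prems(2)[OF that] unfolding sw by auto
    ultimately have "(kempe_change G k)\<^sup>*\<^sup>* ?c d"
      using less.hyps c' by blast
    then show ?thesis using ch by (meson converse_rtranclp_into_rtranclp)
  qed
qed

text \<open>The two colorings differ at \<open>v\<close> alone, so
  \<open>kempe_reach_two_colors\<close> applies with the old color of \<open>v\<close> and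
  \<open>j\<close>.\<close>

lemma kempe_reach_recolor_vertex:
  assumes G: "simple_graph G" and c: "c \<in> colorings G k" and v: "v \<in> verts G" and j: "j \<in> {1..k}"
    and free: "\<And>w. {v, w} \<in> edges G \<Longrightarrow> c w \<noteq> j"
  shows "c(v := j) \<in> colorings G k" "(kempe_change G k)\<^sup>*\<^sup>* c (c(v := j))"
proof -
  have loop: "{u, u} \<notin> edges G" for u
    using G by (force simp: simple_graph_def)
  show col: "c(v := j) \<in> colorings G k"
    using c v j free loop by (auto simp: colorings_def PiE_def extensional_def insert_commute)
  show "(kempe_change G k)\<^sup>*\<^sup>* c (c(v := j))"
  proof (cases "c v = j")
    case True
    then show ?thesis by (simp add: fun_upd_idem)
  next
    case False
    then show ?thesis
      using kempe_reach_two_colors[OF G colorings_range[OF c v] j _ c col] by auto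
  qed
qed

text \<open>The vertices are recolored one at a time. Independence of \<open>W\<close> ensures that
  vertices already moved to \<open>j\<close> never block a later one.\<close>

lemma kempe_reach_recolor_set:
  assumes G: "simple_graph G" and c: "c \<in> colorings G k" and W: "W \<subseteq> verts G" and j: "j \<in> {1..k}"
    and indep: "\<And>u v. u \<in> W \<Longrightarrow> v \<in> W \<Longrightarrow> {u, v} \<notin> edges G"
    and free: "\<And>v w. v \<in> W \<Longrightarrow> {v, w} \<in> edges G \<Longrightarrow> c w \<noteq> j"
  shows "(kempe_change G k)\<^sup>*\<^sup>* c (\<lambda>v. if v \<in> W then j else c v)"
proof -
  have "finite W" using G W finite_subset by (auto simp: simple_graph_def)
  then have "(kempe_change G k)\<^sup>*\<^sup>* c (\<lambda>v. if v \<in> W then j else c v)"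
    using W indep free
  proof (induction W)
    case empty
    then show ?case by simp
  next
    case (insert v W)
    let ?d = "\<lambda>v. if v \<in> W then j else c v"
    have r: "(kempe_change G k)\<^sup>*\<^sup>* c ?d"
      by (rule insert.IH) (use insert.prems in \<open>blast+\<close>)
    have "?d w \<noteq> j" if "{v, w} \<in> edges G" for w
      using that insert.prems by auto
    then have "(kempe_change G k)\<^sup>*\<^sup>* ?d (?d(v := j))"
      using kempe_reach_recolor_vertex(2)[OF G kempe_reach_colorings[OF G r c] _ j] insert.prems(1)
      by auto
    moreover have "?d(v := j) = (\<lambda>w. if w \<in> insert v W then j else c w)" by auto
    ultimately show ?case using r by (metis (no_types, lifting) rtranclp_trans)
  qed
  then show ?thesis .
qed

section \<open>Bipartite graphs plus a matching\<close>

text \<open>Fixes a witness of \<open>B_plus_M\<close>. The bound on the size of \<open>M\<close> is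
  left to the lemmas that count color pairs or build on that count.\<close>

locale bipartite_plus_matching =
  fixes B :: "'a graph" and S T :: "'a set" and M :: "'a set set" and G :: "'a graph" and k :: nat
  assumes bip: "bipartite_with B S T"
    and inside: "\<And>e. e \<in> M \<Longrightarrow> card e = 2 \<and> (e \<subseteq> S \<or> e \<subseteq> T)"
    and matching: "pairwise disjnt M"
    and G_def: "G = Graph (verts B) (edges B \<union> M)"
    and k: "k \<ge> 4"
begin

abbreviation reach :: "('a \<Rightarrow> nat) \<Rightarrow> ('a \<Rightarrow> nat) \<Rightarrow> bool" where
  "reach \<equiv> (kempe_change G k)\<^sup>*\<^sup>*"

lemma verts_G: "verts G = S \<union> T"
  and disj: "S \<inter> T = {}"
  using bip by (auto simp: G_def bipartite_with_def)

lemma simple: "simple_graph G"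
  using bip inside unfolding simple_graph_def bipartite_with_def G_def by auto

lemma edge_cases:
  assumes "{u, v} \<in> edges G"
  obtains "u \<in> S" "v \<in> T" | "u \<in> T" "v \<in> S" | "{u, v} \<in> M" "u \<in> S" "v \<in> S"
    | "{u, v} \<in> M" "u \<in> T" "v \<in> T"
proof -
  from assms consider "{u, v} \<in> M" | "{u, v} \<in> edges B" by (auto simp: G_def)
  then show ?thesis
  proof cases
    case 1
    then show ?thesis using inside[OF 1] that by auto
  next
    case 2
    then obtain s t where "s \<in> S" "t \<in> T" "{u, v} = {s, t}"
      using bip unfolding bipartite_with_def by blast
    then show ?thesis using that by (auto simp: doubleton_eq_iff)
  qed
qed

lemma matching_unique: "{u, v} \<in> M \<Longrightarrow> {u, w} \<in> M \<Longrightarrow> v = w"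
  using pairwiseD[OF matching, of "{u, v}" "{u, w}"] by (auto simp: disjnt_def doubleton_eq_iff)

lemma finite_M: "finite M"
proof (rule finite_subset)
  show "M \<subseteq> Pow (verts G)" using inside verts_G by blast
  show "finite (Pow (verts G))" using simple by (simp add: simple_graph_def)
qed

text \<open>Properness splits into cross edges, checked with the end in \<open>S\<close> first, and
  matching edges, which come with the fact that both ends lie on one side.\<close>

lemma coloringsI:
  assumes "\<And>v. v \<in> S \<union> T \<Longrightarrow> c v \<in> {1..k}" "\<And>v. v \<notin> S \<union> T \<Longrightarrow> c v = undefined"
    and ST: "\<And>u v. u \<in> S \<Longrightarrow> v \<in> T \<Longrightarrow> {u, v} \<in> edges G \<Longrightarrow> c u \<noteq> c v"
    and M: "\<And>u v. {u, v} \<in> M \<Longrightarrow> {u, v} \<subseteq> S \<or> {u, v} \<subseteq> T \<Longrightarrow> c u \<noteq> c v"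
  shows "c \<in> colorings G k"
proof -
  have "c u \<noteq> c v" if "{u, v} \<in> edges G" for u v
    using that
  proof (cases rule: edge_cases)
    case 2
    then show ?thesis using ST[of v u] that by (auto simp: insert_commute)
  qed (use ST M that in auto)
  then show ?thesis
    using assms(1,2) verts_G by (auto simp: colorings_def PiE_def extensional_def)
qed

text \<open>\<open>undefined\<close> is some natural number and might equal \<open>p\<close> or
  \<open>q\<close>; the test \<open>v \<in> S \<union> T\<close> keeps the result
  extensional.\<close>

definition separate :: "nat \<Rightarrow> nat \<Rightarrow> ('a \<Rightarrow> nat) \<Rightarrow> 'a \<Rightarrow> nat" where
  "separate p q c v = (if v \<in> S \<union> T \<and> c v \<in> {p, q} then if v \<in> S then p else q else c v)"

text \<open>Only cross edges have both ends colored in \<open>{p, q}\<close>, so coloring those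
  vertices by side stays proper; the change takes place within two colors.\<close>

lemma reach_separate:
  assumes c: "c \<in> colorings G k" and pq: "p \<in> {1..k}" "q \<in> {1..k}" "p \<noteq> q"
    and M: "\<And>u v. {u, v} \<in> M \<Longrightarrow> \<not> (c u \<in> {p, q} \<and> c v \<in> {p, q})"
  shows "reach c (separate p q c)"
proof -
  have ne: "c u \<noteq> c v" if "{u, v} \<in> edges G" for u v using colorings_edge[OF c that] .
  have "separate p q c \<in> colorings G k"
  proof (rule coloringsI)
    show "separate p q c v \<in> {1..k}" if "v \<in> S \<union> T" for v
      using that pq colorings_range[OF c, of v] verts_G by (auto simp: separate_def)
    show "separate p q c v = undefined" if "v \<notin> S \<union> T" for v
      using that c verts_G by (auto simp: separate_def colorings_def PiE_def extensional_def)
    show "separate p q c u \<noteq> separate p q c v" if "u \<in> S" "v \<in> T" "{u, v} \<in> edges G" for u v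
      using that ne[OF that(3)] disj pq by (auto simp: separate_def)
    show "separate p q c u \<noteq> separate p q c v"
      if "{u, v} \<in> M" "{u, v} \<subseteq> S \<or> {u, v} \<subseteq> T" for u v
      using that ne[of u v] M[OF that(1)] by (auto simp: separate_def G_def)
  qed
  then show ?thesis
    using kempe_reach_two_colors[OF simple pq c] by (auto simp: separate_def)
qed

section \<open>Reaching a coloring with two colors on each side\<close>

definition split_coloring :: "nat \<Rightarrow> nat \<Rightarrow> nat \<Rightarrow> nat \<Rightarrow> ('a \<Rightarrow> nat) \<Rightarrow> bool" where
  "split_coloring a x b y c \<longleftrightarrow> c \<in> colorings G k \<and> c ` S \<subseteq> {a, x} \<and> c ` T \<subseteq> {b, y}"

text \<open>Pigeonhole: each matching edge shows one set of two colors, and there are fewer edges in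
  \<open>M\<close> than such sets. The ends of an edge differ in color, so an edge with both colors
  in \<open>{a, b}\<close> would show exactly that set.\<close>

lemma exists_missing_pair:
  assumes c: "c \<in> colorings G k" and M: "card M < k choose 2"
  obtains a b where "a \<in> {1..k}" "b \<in> {1..k}" "a \<noteq> b"
    "\<And>u v. {u, v} \<in> M \<Longrightarrow> \<not> (c u \<in> {a, b} \<and> c v \<in> {a, b})"
proof -
  let ?P = "{P. P \<subseteq> {1..k} \<and> card P = 2}"
  have "card ((`) c ` M) < card ?P"
    using M card_image_le[OF finite_M, of "(`) c"] n_subsets[of "{1..k}" 2] by simp
  then have "\<not> ?P \<subseteq> (`) c ` M" using finite_M by (meson card_mono finite_imageI not_le)
  then obtain P where P: "P \<subseteq> {1..k}" "card P = 2" "P \<notin> (`) c ` M" by blast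
  then obtain a b where ab: "P = {a, b}" "a \<noteq> b" by (meson card_2_iff)
  have "\<not> (c u \<in> {a, b} \<and> c v \<in> {a, b})" if e: "{u, v} \<in> M" for u v
  proof
    assume "c u \<in> {a, b} \<and> c v \<in> {a, b}"
    moreover have "c u \<noteq> c v" using e colorings_edge[OF c] by (auto simp: G_def)
    ultimately have "c ` {u, v} = P" using ab by auto
    then show False using P e by blast
  qed
  then show ?thesis using that P ab by auto
qed

text \<open>Extremal choice: among the reachable colorings in which \<open>S\<close> avoids
  \<open>b\<close> and \<open>T\<close> avoids \<open>a\<close>, \<open>d\<close> has the fewest
  vertices colored outside \<open>{a, b}\<close>.\<close>

lemma reach_matching_edges_hit:
  assumes c: "c \<in> colorings G k" and ab: "a \<in> {1..k}" "b \<in> {1..k}" "a \<noteq> b"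
    and "b \<notin> c ` S" "a \<notin> c ` T"
  obtains d where "reach c d" "b \<notin> d ` S" "a \<notin> d ` T"
    "\<And>u v. {u, v} \<in> M \<Longrightarrow> u \<in> S \<Longrightarrow> d u = a \<or> d v = a"
    "\<And>u v. {u, v} \<in> M \<Longrightarrow> u \<in> T \<Longrightarrow> d u = b \<or> d v = b"
proof -
  have fin: "finite (verts G)" using simple by (simp add: simple_graph_def)
  let ?R = "\<lambda>d. reach c d \<and> b \<notin> d ` S \<and> a \<notin> d ` T"
  let ?m = "\<lambda>d. card {v \<in> verts G. d v \<notin> {a, b}}"
  obtain d where d: "?R d" and least: "\<And>d'. ?R d' \<Longrightarrow> ?m d \<le> ?m d'"
    using ex_has_least_nat[of ?R c ?m] assms(5,6) by blast
  have dc: "d \<in> colorings G k" using kempe_reach_colorings[OF simple] d c by blast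
  \<comment> \<open>Without such a neighbor, recoloring \<open>v\<close> with \<open>j\<close> would
    contradict minimality.\<close>
  have nbr: "\<exists>w. {v, w} \<in> edges G \<and> d w = j"
    if v: "v \<in> verts G" "d v \<notin> {a, b}" and j: "v \<in> S \<and> j = a \<or> v \<in> T \<and> j = b" for v j
  proof (rule ccontr)
    assume "\<not> ?thesis"
    then have r: "reach d (d(v := j))"
      using kempe_reach_recolor_vertex(2)[OF simple dc v(1), of j] j ab by blast
    have "reach c (d(v := j))" using d r by (meson rtranclp_trans)
    then have "?R (d(v := j))"
      using d j ab disj by (auto simp: image_iff)
    then have "?m d \<le> ?m (d(v := j))" by (rule least)
    moreover have "{w \<in> verts G. (d(v := j)) w \<notin> {a, b}} \<subset> {w \<in> verts G. d w \<notin> {a, b}}"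
      using v j by auto
    then have "?m (d(v := j)) < ?m d" using fin by (intro psubset_card_mono) auto
    ultimately show False by simp
  qed
  show ?thesis
  proof (rule that[of d])
    show "d u = a \<or> d v = a" if e: "{u, v} \<in> M" and u: "u \<in> S" for u v
    proof (rule ccontr)
      assume n: "\<not> ?thesis"
      then obtain w where w: "{u, w} \<in> edges G" "d w = a"
        using nbr[of u a] u d verts_G by auto
      \<comment> \<open>\<open>T\<close> avoids \<open>a\<close>, so the neighbor \<open>w\<close>
        lies in \<open>S\<close> and must be the matching partner of \<open>u\<close>, namely
        \<open>v\<close>.\<close>
      then have "{u, w} \<in> M" using u d disj by (cases rule: edge_cases[OF w(1)]) auto
      then show False using matching_unique e w n by blast
    qed
    show "d u = b \<or> d v = b" if e: "{u, v} \<in> M" and u: "u \<in> T" for u v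
    proof (rule ccontr)
      assume n: "\<not> ?thesis"
      then obtain w where w: "{u, w} \<in> edges G" "d w = b"
        using nbr[of u b] u d verts_G by auto
      then have "{u, w} \<in> M" using u d disj by (cases rule: edge_cases[OF w(1)]) auto
      then show False using matching_unique e w n by blast
    qed
  qed (use d in auto)
qed

lemma reach_split_coloring:
  assumes c: "c \<in> colorings G k" and M: "card M < k choose 2"
  obtains a x b y d where "{a, x, b, y} \<subseteq> {1..k}" "distinct [a, x, b, y]"
    "reach c d" "split_coloring a x b y d"
proof -
  obtain a b where ab: "a \<in> {1..k}" "b \<in> {1..k}" "a \<noteq> b"
    and miss: "\<And>u v. {u, v} \<in> M \<Longrightarrow> \<not> (c u \<in> {a, b} \<and> c v \<in> {a, b})"
    by (rule exists_missing_pair[OF c M]) (rule that)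
  let ?c1 = "separate a b c"
  have r1: "reach c ?c1" using reach_separate[OF c ab miss] .
  have c1: "?c1 \<in> colorings G k" using kempe_reach_colorings[OF simple r1 c] .
  have "b \<notin> ?c1 ` S" "a \<notin> ?c1 ` T" using ab disj by (auto simp: separate_def split: if_splits)
  then obtain c2 where r2: "reach ?c1 c2" and av: "b \<notin> c2 ` S" "a \<notin> c2 ` T"
    and hit: "\<And>u v. {u, v} \<in> M \<Longrightarrow> u \<in> S \<Longrightarrow> c2 u = a \<or> c2 v = a"
      "\<And>u v. {u, v} \<in> M \<Longrightarrow> u \<in> T \<Longrightarrow> c2 u = b \<or> c2 v = b"
    by (rule reach_matching_edges_hit[OF c1 ab]) (rule that)
  have c2: "c2 \<in> colorings G k" using kempe_reach_colorings[OF simple r2 c1] .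
  have "card ({1..k} - {a, b}) \<ge> 2" using ab k by (simp add: card_Diff_subset)
  then obtain P where P: "P \<subseteq> {1..k} - {a, b}" "card P = 2" by (meson obtain_subset_with_card_n)
  then obtain x y where "P = {x, y}" and "x \<noteq> y" by (meson card_2_iff)
  then have xy: "x \<in> {1..k}" "y \<in> {1..k}" "x \<noteq> y" and ne: "{x, y} \<inter> {a, b} = {}"
    using P by auto
  have in_ST: "u \<in> S \<or> u \<in> T" if "{u, v} \<in> M" for u v using inside[OF that] by auto
  \<comment> \<open>Some end of the edge is colored \<open>a\<close> or \<open>b\<close>, hence
    neither \<open>x\<close> nor \<open>y\<close>.\<close>
  have hit': "\<not> (c2 u \<in> {x, y} \<and> c2 v \<in> {x, y})" if "{u, v} \<in> M" for u v
    using hit[OF that] in_ST[OF that] ne by auto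
  define c3 where "c3 = separate x y c2"
  have r3: "reach c2 c3" unfolding c3_def using reach_separate[OF c2 xy hit'] .
  have c3: "c3 \<in> colorings G k" using kempe_reach_colorings[OF simple r3 c2] .
  \<comment> \<open>Separating \<open>x\<close> and \<open>y\<close> leaves the color classes of
    \<open>a\<close> and \<open>b\<close> intact, so \<open>hit\<close> carries over to
    \<open>c3\<close>.\<close>
  have same: "c3 v = a \<longleftrightarrow> c2 v = a" "c3 v = b \<longleftrightarrow> c2 v = b" for v
    using ne by (auto simp: c3_def separate_def)
  have S3: "c3 v \<noteq> b" "c3 v \<noteq> y" if "v \<in> S" for v
    using that av(1) same(2)[of v] xy(3) by (auto simp: c3_def separate_def)
  have T3: "c3 v \<noteq> a" "c3 v \<noteq> x" if v: "v \<in> T" for v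
  proof -
    have "v \<notin> S" using v disj by blast
    then show "c3 v \<noteq> a" "c3 v \<noteq> x"
      using v av(2) same(1)[of v] xy(3) by (auto simp: c3_def separate_def)
  qed
  let ?U = "{v \<in> S. c3 v \<noteq> a}" and ?V = "{v \<in> T. c3 v \<noteq> b}"
  \<comment> \<open>A neighbor inside \<open>S\<close> is the matching partner, which
    \<open>hit\<close> forces to have color \<open>a\<close>. Thus \<open>?U\<close> is independent,
    and since \<open>T\<close> avoids \<open>x\<close>, no neighbor of \<open>?U\<close> is colored
    \<open>x\<close>.\<close>
  have U: "w \<in> T \<or> c3 w = a" if v: "v \<in> ?U" and e: "{v, w} \<in> edges G" for v w
    using e
  proof (cases rule: edge_cases)
    case 3
    then show ?thesis using hit(1)[OF 3(1,2)] v by (simp add: same)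
  qed (use v disj in auto)
  have V: "w \<in> S \<or> c3 w = b" if v: "v \<in> ?V" and e: "{v, w} \<in> edges G" for v w
    using e
  proof (cases rule: edge_cases)
    case 4
    then show ?thesis using hit(2)[OF 4(1,2)] v by (simp add: same)
  qed (use v disj in auto)
  let ?c4 = "\<lambda>v. if v \<in> ?U then x else c3 v"
  have r4: "reach c3 ?c4"
  proof (rule kempe_reach_recolor_set[OF simple c3 _ xy(1)])
    show "?U \<subseteq> verts G" using verts_G by auto
    show "{u, v} \<notin> edges G" if "u \<in> ?U" "v \<in> ?U" for u v using that U[of u v] disj by blast
    show "c3 w \<noteq> x" if "v \<in> ?U" "{v, w} \<in> edges G" for v w
      using U[OF that] T3[of w] ne by auto
  qed
  have c4: "?c4 \<in> colorings G k" using kempe_reach_colorings[OF simple r4 c3] .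
  let ?c5 = "\<lambda>v. if v \<in> ?V then y else ?c4 v"
  have r5: "reach ?c4 ?c5"
  proof (rule kempe_reach_recolor_set[OF simple c4 _ xy(2)])
    show "?V \<subseteq> verts G" using verts_G by auto
    show "{u, v} \<notin> edges G" if "u \<in> ?V" "v \<in> ?V" for u v using that V[of u v] disj by blast
    \<comment> \<open>Recoloring \<open>?U\<close> with \<open>x\<close> brought no \<open>y\<close>
      into \<open>S\<close>, and a neighbor inside \<open>T\<close> has color
      \<open>b\<close>.\<close>
    show "?c4 w \<noteq> y" if "v \<in> ?V" "{v, w} \<in> edges G" for v w
      using V[OF that] S3(2)[of w] ne xy(3) by auto
  qed
  have "?c5 \<in> colorings G k" using kempe_reach_colorings[OF simple r5 c4] .
  then have "split_coloring a x b y ?c5"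
    using disj by (auto simp: split_coloring_def)
  moreover have "reach c ?c5"
    using r1 r2 r3 r4 r5 by (meson rtranclp_trans)
  moreover have "distinct [a, x, b, y]" using ab xy ne by auto
  ultimately show ?thesis using that[of a x b y ?c5] ab xy by auto
qed

section \<open>Permuting colors and comparing split colorings\<close>

lemma reach_transpose:
  assumes s: "split_coloring a x b y c" and ij: "i \<in> {1..k}" "j \<in> {1..k}"
  obtains d where "reach c d"
    "split_coloring (transpose i j a) (transpose i j x) (transpose i j b) (transpose i j y) d"
proof (cases "i = j")
  case True
  then show ?thesis using s that[of c] by simp
next
  case False
  let ?d = "\<lambda>v. if v \<in> S \<union> T then transpose i j (c v) else c v"
  have c: "c \<in> colorings G k" using s by (simp add: split_coloring_def)
  have d: "?d \<in> colorings G k"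
  proof (rule coloringsI)
    show "?d v \<in> {1..k}" if "v \<in> S \<union> T" for v
      using that ij colorings_range[OF c, of v] verts_G by (auto simp: transpose_def)
    show "?d v = undefined" if "v \<notin> S \<union> T" for v
      using that c verts_G by (auto simp: colorings_def PiE_def extensional_def)
    show "?d u \<noteq> ?d v" if "u \<in> S" "v \<in> T" "{u, v} \<in> edges G" for u v
      using that colorings_edge[OF c that(3)] by (auto simp: transpose_eq_iff)
    show "?d u \<noteq> ?d v" if "{u, v} \<in> M" "{u, v} \<subseteq> S \<or> {u, v} \<subseteq> T" for u v
      using that colorings_edge[OF c, of u v] by (auto simp: transpose_eq_iff G_def)
  qed
  then have "reach c ?d"
    using kempe_reach_two_colors[OF simple ij False c, of ?d] by (auto simp: transpose_def)
  moreover have "split_coloring (transpose i j a) (transpose i j x) (transpose i j b)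
    (transpose i j y) ?d"
    using s d by (auto simp: split_coloring_def image_subset_iff)
  ultimately show ?thesis using that by blast
qed

text \<open>The four colors are moved to their targets one after another. Each transposition
  involves only the current color and its target, both distinct from the colors already placed,
  which therefore stay fixed.\<close>

lemma reach_split_coloring_1234:
  assumes s: "split_coloring a x b y c" and "{a, x, b, y} \<subseteq> {1..k}" "distinct [a, x, b, y]"
  obtains d where "reach c d" "split_coloring 1 2 3 4 d"
proof -
  have t: "transpose i j z \<in> {1..k}" if "z \<in> {1..k}" "i \<in> {1..k}" "j \<in> {1..k}" for i j z :: nat
    using that by (auto simp: transpose_def)
  have le: "1 \<in> {1..k}" "2 \<in> {1..k}" "3 \<in> {1..k}" "4 \<in> {1..k}" using k by auto
  define x1 b1 y1 where d1: "x1 = transpose a 1 x" "b1 = transpose a 1 b" "y1 = transpose a 1 y"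
  have k1: "{x1, b1, y1} \<subseteq> {1..k}" "distinct [1, x1, b1, y1]"
    using assms t le unfolding d1 by (auto simp: transpose_def)
  obtain c1 where c1: "reach c c1" "split_coloring 1 x1 b1 y1 c1"
    using reach_transpose[OF s, of a 1] assms(2) le unfolding d1 by auto
  define b2 y2 where d2: "b2 = transpose x1 2 b1" "y2 = transpose x1 2 y1"
  have k2: "{b2, y2} \<subseteq> {1..k}" "distinct [1, 2, b2, y2]"
    using k1 t le unfolding d2 by (auto simp: transpose_def)
  obtain c2 where c2: "reach c1 c2" "split_coloring 1 2 b2 y2 c2"
    using reach_transpose[OF c1(2), of x1 2] k1 le unfolding d2 by (auto simp: transpose_def)
  define y3 where d3: "y3 = transpose b2 3 y2"
  have k3: "y3 \<in> {1..k}" "distinct [1, 2, 3, y3]"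
    using k2 t le unfolding d3 by (auto simp: transpose_def)
  obtain c3 where c3: "reach c2 c3" "split_coloring 1 2 3 y3 c3"
    using reach_transpose[OF c2(2), of b2 3] k2 le unfolding d3 by (auto simp: transpose_def)
  obtain c4 where c4: "reach c3 c4" "split_coloring 1 2 3 4 c4"
    using reach_transpose[OF c3(2), of y3 4] k3 le by (auto simp: transpose_def)
  then show ?thesis using that c1(1) c2(1) c3(1) by (meson rtranclp_trans)
qed

text \<open>The coloring taking \<open>S\<close> from \<open>d\<close> and \<open>T\<close> from
  \<open>c\<close> is an intermediate stop: it is proper because the sides use disjoint palettes and
  matching edges stay inside one side. Each half of the way uses one color pair.\<close>

lemma reach_split_colorings_1234:
  assumes c: "split_coloring 1 2 3 4 c" and d: "split_coloring 1 2 3 4 d"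
  shows "reach c d"
proof -
  let ?e = "\<lambda>v. if v \<in> S then d v else c v"
  have cc: "c \<in> colorings G k" "d \<in> colorings G k" using c d by (auto simp: split_coloring_def)
  have cS: "c v \<in> {1, 2}" "d v \<in> {1, 2}" if "v \<in> S" for v
    using that c d by (auto simp: split_coloring_def)
  have cT: "c v \<in> {3, 4}" "d v \<in> {3, 4}" if "v \<in> T" for v
    using that c d by (auto simp: split_coloring_def)
  have e: "?e \<in> colorings G k"
  proof (rule coloringsI)
    show "?e v \<in> {1..k}" if "v \<in> S \<union> T" for v
      using that cc colorings_range[of _ G k v] verts_G by auto
    show "?e v = undefined" if "v \<notin> S \<union> T" for v
      using that cc verts_G by (auto simp: colorings_def PiE_def extensional_def)
    show "?e u \<noteq> ?e v" if "u \<in> S" "v \<in> T" "{u, v} \<in> edges G" for u v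
      using cS[OF that(1)] cT[OF that(2)] that disj by auto
    show "?e u \<noteq> ?e v" if "{u, v} \<in> M" "{u, v} \<subseteq> S \<or> {u, v} \<subseteq> T" for u v
      using that disj colorings_edge[OF cc(1), of u v] colorings_edge[OF cc(2), of u v]
      by (auto simp: G_def)
  qed
  have "reach c ?e"
    using cS k by (intro kempe_reach_two_colors[OF simple _ _ _ cc(1) e, of 1 2]) auto
  moreover have "reach ?e d"
    using cT k verts_G by (intro kempe_reach_two_colors[OF simple _ _ _ e cc(2), of 3 4]) auto
  ultimately show ?thesis by (rule rtranclp_trans)
qed

text \<open>With no coloring there would be zero classes. A coloring arises by choosing one end
  \<open>f e\<close> of each matching edge and giving chosen and other vertices different colors on
  each side.\<close>

lemma colorings_nonempty: "colorings G k \<noteq> {}"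
proof -
  define f :: "'a set \<Rightarrow> 'a" where "f e = (SOME v. v \<in> e)" for e
  have f: "f e \<in> e" if "e \<in> M" for e
    using inside[OF that] unfolding f_def some_in_eq by auto
  have fM: "v \<in> f ` M \<longleftrightarrow> f {u, v} = v" if "{u, v} \<in> M" for u v
  proof
    assume "v \<in> f ` M"
    then obtain e where e: "e \<in> M" "v = f e" by blast
    \<comment> \<open>Both edges contain \<open>v\<close>, and distinct edges of \<open>M\<close>
      are disjoint.\<close>
    then have "e = {u, v}"
      using f[OF e(1)] pairwiseD[OF matching e(1) that] by (auto simp: disjnt_def)
    then show "f {u, v} = v" using e by simp
  qed (use that in \<open>metis imageI\<close>)
  define c :: "'a \<Rightarrow> nat" where "c v = (if v \<in> S then if v \<in> f ` M then 1 else 2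
    else if v \<in> T then if v \<in> f ` M then 3 else 4 else undefined)" for v
  have "c \<in> colorings G k"
  proof (rule coloringsI)
    show "c v \<in> {1..k}" if "v \<in> S \<union> T" for v using that k by (auto simp: c_def)
    show "c v = undefined" if "v \<notin> S \<union> T" for v using that by (auto simp: c_def)
    show "c u \<noteq> c v" if "u \<in> S" "v \<in> T" for u v using that disj by (auto simp: c_def)
    show "c u \<noteq> c v" if e: "{u, v} \<in> M" and ins: "{u, v} \<subseteq> S \<or> {u, v} \<subseteq> T" for u v
    proof -
      have "u \<noteq> v" using inside[OF e] by auto
      moreover have "u \<in> f ` M \<longleftrightarrow> f {u, v} = u" "v \<in> f ` M \<longleftrightarrow> f {u, v} = v"
        using fM[of v u] fM[of u v] e by (auto simp: insert_commute)
      moreover have "f {u, v} \<in> {u, v}" using f[OF e] .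
      ultimately have "u \<in> f ` M \<longleftrightarrow> v \<notin> f ` M" by auto
      then show ?thesis using ins disj by (auto simp: c_def)
    qed
  qed
  then show ?thesis by blast
qed

text \<open>Both colorings are led to split colorings on 1, 2, 3, 4, which reach each other;
  reversibility of Kempe changes turns the second path around.\<close>

lemma Kc_eq_1:
  assumes M: "card M < k choose 2"
  shows "Kc G k = 1"
proof -
  have canon: "\<exists>d. reach c d \<and> split_coloring 1 2 3 4 d" if c: "c \<in> colorings G k" for c
  proof -
    obtain a x b y d where "{a, x, b, y} \<subseteq> {1..k}" "distinct [a, x, b, y]"
      and d: "reach c d" "split_coloring a x b y d"
      by (rule reach_split_coloring[OF c M]) (rule that)
    then obtain e where "reach d e" "split_coloring 1 2 3 4 e"
      using reach_split_coloring_1234[OF d(2)] by metis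
    then show ?thesis using d(1) by (meson rtranclp_trans)
  qed
  have "reach c d" if c: "c \<in> colorings G k" and d: "d \<in> colorings G k" for c d
  proof -
    obtain c' d' where c': "reach c c'" "split_coloring 1 2 3 4 c'"
      and d': "reach d d'" "split_coloring 1 2 3 4 d'"
      using canon c d by blast
    have "reach c' d'" using reach_split_colorings_1234 c'(2) d'(2) .
    moreover have "reach d' d" using kempe_reach_sym[OF simple d'(1) d] .
    ultimately show ?thesis using c'(1) by (meson rtranclp_trans)
  qed
  then show ?thesis using Kc_eq_1_iff[OF simple] colorings_nonempty by blast
qed

end

theorem theorem1:
  fixes k l :: nat and G :: "'a graph"
  assumes "k \<ge> 4"
    and "l < k choose 2"
    and "B_plus_M l G"
  shows "Kc G k = 1"
proof -
  obtain B S T M where "bipartite_with B S T" "\<forall>e\<in>M. card e = 2 \<and> (e \<subseteq> S \<or> e \<subseteq> T)"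
    "pairwise disjnt M" and l: "card M = l" and "G = Graph (verts B) (edges B \<union> M)"
    using assms(3) unfolding B_plus_M_def by blast
  then interpret bipartite_plus_matching B S T M G k
    using assms(1) by unfold_locales auto
  show ?thesis using Kc_eq_1 assms(2) l by simp
qed

end
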